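(* Let $m\geq 1$ and $n\geq 2$, and let $p(m,n)$ be the number of Fibonacci polyominoes with horizontal semiperimeter $m$ and vertical semiperimeter $n$. Then \[ p(m,n)=C_m\binom{n-2}{m-1}+C_{m-1}\binom{n-2}{m-2}, \] where $C_k=\frac{1}{k+1}\binom{2k}{k}$ is the $k$th Catalan number. Moreover, the first term $C_m\binom{n-2}{m-1}$ is the number of those polyominoes whose last (rightmost) column has height at least $2$, and the second term $C_{m-1}\binom{n-2}{m-2}$ is the number of those whose last column has height $1$. In particular, $p(n,n)=C_{n-1}$ for every $n\geq 2$.
   Context: A Fibonacci polyomino is a (nonempty) polyomino, considered up to translation, that is column-convex (each column is a contiguous segment of unit cells) and such that, reading columns from left to right, the bottom cell of each column lies exactly one unit above the bottom cell of the preceding column. Equivalently, it is given by a sequence of column heights $(h_1,\dots,h_m)$, $m\ge 1$, with $h_i\ge 2$ for $1\le i\le m-1$ and $h_m\ge 1$; column $i$ consists of the cells in column position $i$ and rows $i,i+1,\dots,i+h_i-1$. The horizontal (resp. vertical) semiperimeter of a polyomino is half the number of horizontal (resp. vertical) unit edges on its boundary (a boundary edge is a unit edge belonging to exactly one cell). A binomial coefficient $\binom{a}{b}$ with $a\ge 0$ is $0$ if $b<0$ or $b>a$. *)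

theory Defs
  imports Complex_Main
begin

text \<open>The pair \<open>(x, y)\<close> denotes the unit cell \<open>[x, x+1] \<times> [y, y+1]\<close>:
  \<open>x\<close> is the column position and \<open>y\<close> the row.\<close>

type_synonym cell = "int \<times> int"

definition adjacent :: "cell \<Rightarrow> cell \<Rightarrow> bool" where
  "adjacent c d \<longleftrightarrow> \<bar>fst c - fst d\<bar> + \<bar>snd c - snd d\<bar> = 1"

definition polyomino :: "cell set \<Rightarrow> bool" where
  "polyomino P \<longleftrightarrow> finite P \<and> P \<noteq> {} \<and>
     (\<forall>c\<in>P. \<forall>d\<in>P. (c, d) \<in> {(a, b). a \<in> P \<and> b \<in> P \<and> adjacent a b}\<^sup>*)"

definition column :: "cell set \<Rightarrow> int \<Rightarrow> int set" where
  "column P i = {j. (i, j) \<in> P}"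

definition column_convex :: "cell set \<Rightarrow> bool" where
  "column_convex P \<longleftrightarrow> (\<forall>i. \<exists>a b. column P i = {a..b})"

text \<open>Connectedness makes the nonempty columns occupy consecutive positions, so the column
  preceding the one at position \<open>i + 1\<close> is the one at position \<open>i\<close>.\<close>

definition fibonacci_polyomino :: "cell set \<Rightarrow> bool" where
  "fibonacci_polyomino P \<longleftrightarrow> polyomino P \<and> column_convex P \<and>
     (\<forall>i. column P i \<noteq> {} \<longrightarrow> column P (i + 1) \<noteq> {} \<longrightarrow>
        Min (column P (i + 1)) = Min (column P i) + 1)"

text \<open>A horizontal unit edge is named by its left endpoint, a vertical one by its lower endpoint.\<close>

definition horizontal_edges :: "cell \<Rightarrow> (int \<times> int) set" where
  "horizontal_edges c = {(fst c, snd c), (fst c, snd c + 1)}"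

definition vertical_edges :: "cell \<Rightarrow> (int \<times> int) set" where
  "vertical_edges c = {(fst c, snd c), (fst c + 1, snd c)}"

definition horizontal_semiperimeter :: "cell set \<Rightarrow> real" where
  "horizontal_semiperimeter P = real (card {e. \<exists>!c. c \<in> P \<and> e \<in> horizontal_edges c}) / 2"

definition vertical_semiperimeter :: "cell set \<Rightarrow> real" where
  "vertical_semiperimeter P = real (card {e. \<exists>!c. c \<in> P \<and> e \<in> vertical_edges c}) / 2"

definition last_column_height :: "cell set \<Rightarrow> nat" where
  "last_column_height P = card (column P (Max (fst ` P)))"

definition translate :: "int \<times> int \<Rightarrow> cell set \<Rightarrow> cell set" where
  "translate v P = (\<lambda>c. (fst c + fst v, snd c + snd v)) ` P"

definition translation_rel :: "(cell set \<times> cell set) set" where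
  "translation_rel = {(P, Q). \<exists>v. Q = translate v P}"

definition fib_polyominoes :: "nat \<Rightarrow> nat \<Rightarrow> cell set set" where
  "fib_polyominoes m n = {P. fibonacci_polyomino P \<and>
     horizontal_semiperimeter P = real m \<and> vertical_semiperimeter P = real n}"

definition num_fib_polyominoes :: "nat \<Rightarrow> nat \<Rightarrow> nat" where
  "num_fib_polyominoes m n = card (fib_polyominoes m n // translation_rel)"

definition catalan :: "nat \<Rightarrow> real" where
  "catalan k = 1 / (real k + 1) * real ((2 * k) choose k)"

text \<open>The lower index may be negative, where \<open>(choose)\<close> with truncated subtraction on \<open>nat\<close>
  would give the wrong value: \<open>n - 2\<close> over \<open>m - 2\<close> must vanish for \<open>m = 1\<close>.\<close>

definition binom :: "nat \<Rightarrow> int \<Rightarrow> nat" where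
  "binom a b = (if b < 0 then 0 else a choose (nat b))"

lemma equiv_translation_rel: "equiv UNIV translation_rel"
proof (rule equivI)
  show "translation_rel \<subseteq> UNIV \<times> UNIV" by simp
  show "refl translation_rel"
    by (rule refl_onI) (auto simp: translation_rel_def translate_def intro!: exI[of _ 0])
  show "sym translation_rel"
  proof (rule symI)
    fix P Q assume "(P, Q) \<in> translation_rel"
    then obtain v where "Q = translate v P" by (auto simp: translation_rel_def)
    then have "P = translate (- fst v, - snd v) Q"
      by (simp add: translate_def image_image)
    then show "(Q, P) \<in> translation_rel" by (auto simp: translation_rel_def)
  qed
  show "trans translation_rel"
  proof (rule transI)
    fix P Q R assume "(P, Q) \<in> translation_rel" "(Q, R) \<in> translation_rel"
    then obtain v w where "Q = translate v P" "R = translate w Q"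
      by (auto simp: translation_rel_def)
    then have "R = translate (fst v + fst w, snd v + snd w) P"
      by (simp add: translate_def image_image add.assoc)
    then show "(P, R) \<in> translation_rel" by (auto simp: translation_rel_def)
  qed
qed

end

theory Submission
  imports Defs
begin

text \<open>Reading off column heights turns the problem into counting sequences \<open>h\<^sub>1, \<dots>, h\<^sub>m\<close>, with
  \<open>n = h\<^sub>1 + (\<Sum>i<m. max 0 (h\<^sub>i\<^sub>+\<^sub>1 + 1 - h\<^sub>i))\<close> because the boundary edges between two adjacent columns
  number \<open>1 + \<bar>h\<^sub>i\<^sub>+\<^sub>1 + 1 - h\<^sub>i\<bar>\<close> and the signed parts telescope.
  Put \<open>g\<^sub>i = h\<^sub>i - 1\<close> and \<open>N = n - 1\<close>. A step from \<open>g\<close> to \<open>k\<close> has weight \<open>x\<close> to the power \<open>max 0 (k + 1 - g)\<close>,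
  which is \<open>1 - x\<close> times the total weight of all ways to go up by some \<open>u \<ge> 0\<close> (weight \<open>x\<close> per unit)
  and then down by some \<open>d \<ge> 1\<close>. The sequences relaxed in this way are pairs of a strictly increasing sequence of
  total descents below a weakly increasing sequence of total ascents; they are counted by a
  two-by-two determinant of binomial coefficients. The factors \<open>1 - x\<close> become iterated backward differences in \<open>N\<close>.
  Finally, a last column of height 1 adds nothing to \<open>n\<close>, so summing over all last heights \<open>\<ge> 2\<close>
  is the same as evaluating the refined count of length \<open>m + 1\<close> at last height 1, where the determinant
  collapses to \<open>C\<^sub>m\<close> times a single binomial coefficient.\<close>

section \<open>Counting the relaxed sequences\<close>

definition backward_diff :: "(int \<Rightarrow> int \<Rightarrow> int) \<Rightarrow> int \<Rightarrow> int \<Rightarrow> int" where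
  "backward_diff f N k = f N k - f (N - 1) k"

text \<open>Appends a last term \<open>k\<close> after a term \<open>j\<close>. The range starts at
  1 because every height but the last is at least 2, and it stops at \<open>N\<close> because no
  term exceeds the total ascent.\<close>

definition transfer :: "(int \<Rightarrow> int \<Rightarrow> int) \<Rightarrow> int \<Rightarrow> int \<Rightarrow> int" where
  "transfer f N k = (if k < 0 then 0 else \<Sum>j\<in>{1..N}. f (N - max 0 (k + 1 - j)) j)"

lemma transfer_backward_diff:
  assumes "\<And>N k. N < k \<Longrightarrow> f N k = 0"
  shows "transfer (backward_diff f) = backward_diff (transfer f)"
proof (intro ext)
  fix N k :: int
  show "transfer (backward_diff f) N k = backward_diff (transfer f) N k"
  proof (cases "k < 0 \<or> N < 1")
    case True
    then show ?thesis by (auto simp: transfer_def backward_diff_def)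
  next
    case False
    have *: "{1..N} = insert N {1..N-1}" using False by auto
    \<comment> \<open>In the copy shifted to \<open>N - 1\<close> the term \<open>j = N\<close>
      vanishes, since the first argument of \<open>f\<close> is then below \<open>N\<close>.\<close>
    have "(\<Sum>j\<in>{1..N}. f (N - max 0 (k + 1 - j) - 1) j)
        = (\<Sum>j\<in>{1..N-1}. f (N - 1 - max 0 (k + 1 - j)) j)"
      unfolding * using assms by (simp add: algebra_simps)
    then show ?thesis using False
      by (simp add: transfer_def backward_diff_def sum_subtractf)
  qed
qed

lemma backward_diff_funpow_eq_0:
  assumes "\<And>N k. N < k \<Longrightarrow> f N k = 0" "N < k"
  shows "(backward_diff ^^ i) f N k = 0"
  using assms(2) by (induction i arbitrary: N) (auto simp: backward_diff_def assms(1))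

lemma transfer_backward_diff_funpow:
  assumes "\<And>N k. N < k \<Longrightarrow> f N k = 0"
  shows "transfer ((backward_diff ^^ i) f) = (backward_diff ^^ i) (transfer f)"
  by (induction i) (simp_all add: transfer_backward_diff backward_diff_funpow_eq_0 assms)

text \<open>For \<open>m = M + 2\<close> terms, total ascent \<open>N\<close> and total descent \<open>f + 1\<close>. The subtracted product
  is fixed by requiring the count to vanish where the two sequences meet, which is \<open>choose_reflection\<close>.\<close>

definition two_row_det :: "nat \<Rightarrow> nat \<Rightarrow> nat \<Rightarrow> int" where
  "two_row_det M N f = int (((N + M) choose (M + 1)) * (f choose M))
     - (if M = 0 then 0 else int (((N + M) choose (M - 1)) * ((f + 2) choose (M + 2))))"

text \<open>Sequences of length \<open>i + 1\<close> with total ascent \<open>N\<close> and last term \<open>k\<close>.\<close>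

fun relaxed_count :: "nat \<Rightarrow> int \<Rightarrow> int \<Rightarrow> int" where
  "relaxed_count 0 N k = (if N = k \<and> 0 \<le> k then 1 else 0)"
| "relaxed_count (Suc M) N k = (if 0 \<le> k \<and> k < N then two_row_det M (nat N) (nat (N - k - 1)) else 0)"

lemma relaxed_count_eq_0: "N < k \<Longrightarrow> relaxed_count i N k = 0"
  by (cases i) auto

section \<open>Binomial identities behind the determinant\<close>

lemma choose_add_fact: "real ((a + b) choose a) = fact (a + b) / (fact a * fact b)"
  by (simp add: binomial_fact del: fact_Suc)

text \<open>Both sides are the multinomial coefficient splitting \<open>g + M + 2\<close> into
  \<open>M + 2\<close>, \<open>M\<close> and \<open>g - M\<close>; for \<open>g < M\<close> both
  vanish.\<close>

lemma choose_reflection: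
  "((g + M + 2) choose (M + 2)) * (g choose M) = ((g + M + 2) choose M) * ((g + 2) choose (M + 2))"
proof (cases "M \<le> g")
  case True
  then obtain t where t: "g = M + t" using le_Suc_ex by blast
  have 1: "g + M + 2 = (M + 2) + g" "g + M + 2 = M + (g + 2)" "g + 2 = (M + 2) + t"
    using t by simp_all
  have a: "real ((g + M + 2) choose (M + 2)) = fact (g + M + 2) / (fact (M + 2) * fact g)"
    unfolding 1(1) by (rule choose_add_fact)
  have b: "real ((g + M + 2) choose M) = fact (g + M + 2) / (fact M * fact (g + 2))"
    unfolding 1(2) by (rule choose_add_fact)
  have c: "real ((g + 2) choose (M + 2)) = fact (g + 2) / (fact (M + 2) * fact t)"
    unfolding 1(3) by (rule choose_add_fact)
  have d: "real (g choose M) = fact g / (fact M * fact t)"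
    unfolding t by (rule choose_add_fact)
  have "real (((g + M + 2) choose (M + 2)) * (g choose M))
      = real (((g + M + 2) choose M) * ((g + 2) choose (M + 2)))"
    unfolding of_nat_mult a b c d by (simp add: field_simps del: fact_Suc)
  then show ?thesis by (simp only: of_nat_eq_iff)
next
  case False
  then have "g choose M = 0" "(g + 2) choose (M + 2) = 0" by (auto intro!: binomial_eq_0)
  then show ?thesis by (simp only: mult_0_right)
qed

text \<open>Collects the last steps that leave the total ascent at \<open>N\<close> and vary the
  descent; Pascal's rule telescopes in the second factors.\<close>

lemma sum_two_row_det_column:
  "(\<Sum>g'\<le>g. two_row_det M N g') = int (((N + M) choose (M + 1)) * ((g + 1) choose (M + 1)))
     - (if M = 0 then 0 else int (((N + M) choose (M - 1)) * ((g + 3) choose (M + 3))))"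
proof (induction g)
  case 0
  then show ?case
    by (cases M) (auto simp: two_row_det_def numeral_eq_Suc)
next
  case (Suc g)
  have "(Suc g + 1) choose (M + 1) = ((g + 1) choose (M + 1)) + (Suc g choose M)"
    "(Suc g + 3) choose (M + 3) = ((g + 3) choose (M + 3)) + ((Suc g + 2) choose (M + 2))"
    by (simp_all add: numeral_eq_Suc)
  then show ?case using Suc
    by (simp only: sum.atMost_Suc) (simp add: two_row_det_def algebra_simps)
qed

text \<open>Collects the last steps with fixed descent and varying ascent, so Pascal's rule
  telescopes in the first factors. The sum starts at ascent \<open>g + 2\<close>, where
  \<open>choose_reflection\<close> cancels the two boundary terms.\<close>

lemma sum_two_row_det_row:
  "(\<Sum>i<t. two_row_det M (g + 2 + i) g) = int (((g + M + 2 + t) choose (M + 2)) * (g choose M))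
     - int (((g + M + 2 + t) choose M) * ((g + 2) choose (M + 2)))"
proof (induction t)
  case 0
  show ?case using choose_reflection[of g M] by (simp del: of_nat_mult)
next
  case (Suc t)
  have 1: "(g + M + 2 + Suc t) choose (M + 2)
      = ((g + M + 2 + t) choose (M + 2)) + ((g + 2 + t + M) choose (M + 1))"
    by (simp add: numeral_eq_Suc add.commute add.left_commute)
  have 2: "(g + M + 2 + Suc t) choose M
      = ((g + M + 2 + t) choose M) + (if M = 0 then 0 else ((g + 2 + t + M) choose (M - 1)))"
    by (cases M) (simp_all add: add.commute add.left_commute)
  show ?case unfolding 1 2 sum.lessThan_Suc Suc two_row_det_def[of M "g + 2 + t" g]
    by (simp add: algebra_simps del: binomial_Suc_Suc)
qed

text \<open>Here \<open>t\<close> stands for the last term \<open>k\<close> and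
  \<open>N = g + 2 + t\<close>: lowering \<open>N\<close> at fixed \<open>k\<close> lowers the
  descent as well. The first sum covers previous terms above \<open>k\<close>, the second those from
  1 to \<open>k\<close>.\<close>

lemma two_row_det_step:
  "two_row_det (Suc M) (g + 2 + t) (Suc g) - two_row_det (Suc M) (g + 1 + t) g
   = (\<Sum>g'\<le>g. two_row_det M (g + 2 + t) g') + (\<Sum>i<t. two_row_det M (g + 2 + i) g)"
proof -
  have 1: "(g + 2 + t + Suc M) choose (M + 2)
      = ((g + M + 2 + t) choose (M + 2)) + ((g + 2 + t + M) choose (M + 1))"
    by (simp add: numeral_eq_Suc add.commute add.left_commute)
  have 2: "(g + 2 + t + Suc M) choose M
      = ((g + M + 2 + t) choose M) + (if M = 0 then 0 else ((g + 2 + t + M) choose (M - 1)))"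
    by (cases M) (simp_all add: add.commute add.left_commute)
  have 3: "Suc g choose Suc M = (g choose Suc M) + (g choose M)"
    "(g + 3) choose (M + 3) = ((g + 2) choose (M + 3)) + ((g + 2) choose (M + 2))"
    by (simp_all add: numeral_eq_Suc)
  have 4: "g + 1 + t + Suc M = g + M + 2 + t" "Suc M + 1 = M + 2" "Suc M - 1 = M"
    "Suc g + 2 = g + 3" "Suc M + 2 = M + 3" "g + 1 = Suc g" "M + 1 = Suc M" "Suc M \<noteq> 0"
    by simp_all
  show ?thesis
    unfolding sum_two_row_det_column sum_two_row_det_row
    unfolding two_row_det_def[of "Suc M"] 4 1[unfolded 4] 2 3
    by (cases M) (simp_all add: algebra_simps)
qed

text \<open>The relaxed steps from \<open>j\<close> to \<open>k\<close> have ascents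
  \<open>u \<ge> max 0 (k + 1 - j)\<close>, a geometric series, so one difference leaves only the
  minimal ascent, as in \<open>transfer\<close>. On the closed form this becomes
  \<open>two_row_det_step\<close>.\<close>

lemma backward_diff_relaxed_count:
  "backward_diff (relaxed_count (Suc i)) = transfer (relaxed_count i)"
proof (intro ext)
  fix N k :: int
  show "backward_diff (relaxed_count (Suc i)) N k = transfer (relaxed_count i) N k"
  proof (cases "0 \<le> k \<and> k < N")
    case False
    have "relaxed_count i (N - max 0 (k + 1 - j)) j = 0" if "0 \<le> k" "j \<in> {1..N}" for j
      using that False by (intro relaxed_count_eq_0) auto
    then show ?thesis using False by (auto simp: backward_diff_def transfer_def)
  next
    case True
    show ?thesis
    proof (cases i)
      case 0
      \<comment> \<open>A term is nonzero iff the reduced ascent equals \<open>j\<close>: for every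
        \<open>j\<close> if \<open>N = k + 1\<close>, otherwise only for
        \<open>j = N\<close>.\<close>
      have "(\<Sum>j\<in>{1..N}. relaxed_count 0 (N - max 0 (k + 1 - j)) j)
         = (\<Sum>j\<in>{1..N}. if j \<in> (if N = k + 1 then {1..N} else {N}) then 1 else 0)"
        using True by (intro sum.cong) (auto simp: max_def)
      also have "\<dots> = (if N = k + 1 then N else 1)"
        using True by (auto simp: sum.If_cases)
      finally show ?thesis using 0 True
        by (auto simp: backward_diff_def transfer_def two_row_det_def)
    next
      case (Suc M)
      define f where "f = nat (N - k - 1)"
      have Nf: "N = k + 1 + int f" using True by (simp add: f_def)
      show ?thesis
      proof (cases f)
        case 0
        have "relaxed_count i (N - max 0 (k + 1 - j)) j = 0" if "j \<in> {1..N}" for j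
          using that 0 Nf Suc by auto
        then have "transfer (relaxed_count i) N k = 0" by (simp add: transfer_def)
        then show ?thesis using True 0 Nf Suc
          by (simp add: backward_diff_def two_row_det_def numeral_eq_Suc)
      next
        case fg: (Suc g)
        obtain t where t: "k = int t" using True nonneg_eq_int by blast
        have N: "N = int (g + 2 + t)" using Nf fg t by simp
        \<comment> \<open>Up to \<open>j = k\<close> the descent parameter stays \<open>g\<close>
          while the ascent varies; beyond \<open>k\<close> the ascent stays \<open>N\<close> and the
          parameter \<open>N - 1 - j\<close> varies.\<close>
        have split: "{1..N} = {1..k} \<union> {k+1..N}" "{1..k} \<inter> {k+1..N} = {}"
          using True by auto
        have a: "(\<Sum>j\<in>{1..k}. relaxed_count i (N - max 0 (k + 1 - j)) j)
           = (\<Sum>i<t. two_row_det M (g + 2 + i) g)"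
          by (rule sum.reindex_bij_witness[where i = "\<lambda>i. int i + 1" and j = "\<lambda>j. nat (j - 1)"])
             (auto simp: t N Suc nat_add_distrib max_def intro!: arg_cong2[where f = "two_row_det M"])
        have b: "(\<Sum>j\<in>{k+1..N}. relaxed_count i (N - max 0 (k + 1 - j)) j)
           = (\<Sum>j\<in>{k+1..<N}. relaxed_count i (N - max 0 (k + 1 - j)) j)"
          by (rule sum.mono_neutral_right) (auto simp: Suc)
        have c: "(\<Sum>j\<in>{k+1..<N}. relaxed_count i (N - max 0 (k + 1 - j)) j)
           = (\<Sum>g'\<le>g. two_row_det M (g + 2 + t) g')"
          by (rule sum.reindex_bij_witness[where i = "\<lambda>g'. N - 1 - int g'" and j = "\<lambda>j. nat (N - 1 - j)"])
             (auto simp: t N Suc max_def algebra_simps intro!: arg_cong2[where f = "two_row_det M"])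
        have "transfer (relaxed_count i) N k
           = (\<Sum>g'\<le>g. two_row_det M (g + 2 + t) g') + (\<Sum>i<t. two_row_det M (g + 2 + i) g)"
          using True unfolding transfer_def split(1)
          by (subst sum.union_disjoint) (use split a b c in auto)
        also have "\<dots> = two_row_det (Suc M) (g + 2 + t) (Suc g) - two_row_det (Suc M) (g + 1 + t) g"
          by (rule two_row_det_step[symmetric])
        also have "\<dots> = backward_diff (relaxed_count (Suc i)) N k"
          by (auto simp: backward_diff_def Suc N t intro!: arg_cong2[where f = "(-)"] arg_cong2[where f = "two_row_det (Suc M)"])
        finally show ?thesis by simp
      qed
    qed
  qed
qed

text \<open>At last term 0 total ascent and descent agree. For \<open>0 < M \<le> g\<close> the
  second product is \<open>M / (M + 2)\<close> times the first, and the remaining factor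
  \<open>2 / (M + 2)\<close> produces the Catalan number.\<close>

lemma two_row_det_diagonal:
  "real_of_int (two_row_det M (Suc g) g) = catalan (Suc M) * real ((g + M + 1) choose (2 * M + 1))"
proof (cases "M \<le> g")
  case True
  then obtain t where t: "g = M + t" using le_Suc_ex by blast
  show ?thesis
  proof (cases M)
    case 0
    then show ?thesis by (simp add: two_row_det_def catalan_def)
  next
    case (Suc L)
    have 1: "Suc g + M = 2 * M + 1 + t" "g + M + 1 = 2 * M + 1 + t" "g + 2 = M + 2 + t" using t by auto
    have 2: "2 * M + 1 + t = (M + 1) + (M + t)" "2 * M + 1 + t = L + (M + 2 + t)" "2 * Suc M = Suc M + Suc M"
      by (simp_all add: Suc)
    have a: "real ((2 * M + 1 + t) choose (M + 1)) = fact (2 * M + 1 + t) / (fact (M + 1) * fact (M + t))"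
      unfolding 2(1) by (rule choose_add_fact)
    have b: "real (g choose M) = fact (M + t) / (fact M * fact t)"
      unfolding t by (rule choose_add_fact)
    have c: "real ((2 * M + 1 + t) choose L) = fact (2 * M + 1 + t) / (fact L * fact (M + 2 + t))"
      unfolding 2(2) by (rule choose_add_fact)
    have d: "real ((M + 2 + t) choose (M + 2)) = fact (M + 2 + t) / (fact (M + 2) * fact t)"
      by (rule choose_add_fact)
    have e: "real ((2 * M + 1 + t) choose (2 * M + 1)) = fact (2 * M + 1 + t) / (fact (2 * M + 1) * fact t)"
      by (rule choose_add_fact)
    have f: "catalan (Suc M) = 1 / (real M + 2) * (fact (2 * M + 2) / (fact (M + 1) * fact (M + 1)))"
    proof -
      have "real ((2 * Suc M) choose Suc M) = fact (2 * Suc M) / (fact (Suc M) * fact (Suc M))"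
        unfolding 2(3) by (rule choose_add_fact)
      then show ?thesis by (simp add: catalan_def del: fact_Suc binomial_Suc_Suc)
    qed
    have g: "fact (M + 1) = (real M + 1) * fact M" "fact (M + 2) = (real M + 2) * ((real M + 1) * fact M)"
      "fact M = real M * fact L" "fact (2 * M + 2) = (2 * real M + 2) * fact (2 * M + 1)"
      by (simp_all add: Suc algebra_simps)
    \<comment> \<open>Factorials abstracted: \<open>x = M\<close>, \<open>l = L!\<close>,
      \<open>w = t!\<close>, hence \<open>x * l = M!\<close>; \<open>F\<close>, \<open>G\<close>,
      \<open>H\<close>, \<open>K\<close> are the factorials of \<open>2 * M + 1 + t\<close>,
      \<open>M + t\<close>, \<open>M + 2 + t\<close>, \<open>2 * M + 1\<close>.\<close>
    have key: "F / ((x + 1) * (x * l) * G) * (G / (x * l * w)) - F / (l * H) * (H / ((x + 2) * ((x + 1) * (x * l)) * w))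
      = 1 / (x + 2) * ((2 * x + 2) * K / ((x + 1) * (x * l) * ((x + 1) * (x * l)))) * (F / (K * w))"
      if "x > 0" "l > 0" "w > 0" "G > 0" "H > 0" "K > 0" for x l w F G H K :: real
    proof -
      have "F / ((x + 1) * (x * l) * G) * (G / (x * l * w)) = F / ((x + 1) * (x * l) * (x * l) * w)"
        using that by simp
      moreover have "F / (l * H) * (H / ((x + 2) * ((x + 1) * (x * l)) * w))
          = F / ((x + 1) * (x * l) * (x * l) * w) * (x / (x + 2))"
        using that by (simp add: divide_simps)
      moreover have "1 / (x + 2) * ((2 * x + 2) * K / ((x + 1) * (x * l) * ((x + 1) * (x * l)))) * (F / (K * w))
          = F / ((x + 1) * (x * l) * (x * l) * w) * (2 / (x + 2))"
      proof -
        have "(2 * x + 2) * K / ((x + 1) * (x * l) * ((x + 1) * (x * l))) = 2 * K / ((x + 1) * (x * l) * (x * l))"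
          using that by (simp add: divide_simps)
        then show ?thesis using that by (simp add: mult_ac)
      qed
      moreover have "1 - x / (x + 2) = 2 / (x + 2)" using that by (simp add: field_simps)
      ultimately show ?thesis by (metis mult.right_neutral right_diff_distrib)
    qed
    have MS: "M \<noteq> 0" and L: "M - 1 = L" using Suc by simp_all
    have "real_of_int (two_row_det M (Suc g) g) =
       real ((2 * M + 1 + t) choose (M + 1)) * real (g choose M)
       - real ((2 * M + 1 + t) choose (M - 1)) * real ((M + 2 + t) choose (M + 2))"
      using MS unfolding two_row_det_def 1 by simp
    also have "\<dots> = catalan (Suc M) * real ((g + M + 1) choose (2 * M + 1))"
      unfolding 1 a b L c d e f g by (rule key) (simp_all add: Suc del: fact_Suc)
    finally show ?thesis .
  qed
next
  case False
  then have "g choose M = 0" "(g + 2) choose (M + 2) = 0" "(g + M + 1) choose (2 * M + 1) = 0"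
    by (auto intro!: binomial_eq_0)
  then show ?thesis unfolding two_row_det_def by (simp only: mult_0_right) simp
qed

text \<open>Each difference is one use of Pascal's rule, lowering both binomial arguments by one;
  the bound on \<open>i\<close> keeps the truncated upper argument exact.\<close>

lemma iterated_backward_diff_relaxed_count_0:
  assumes "i \<le> Suc M"
  shows "real_of_int ((backward_diff ^^ i) (relaxed_count (Suc M)) N 0)
   = (if N \<le> 0 then 0 else catalan (Suc M) * real ((nat N + M - i) choose (2 * M + 1 - i)))"
  using assms
proof (induction i arbitrary: N)
  case 0
  show ?case
  proof (cases "N \<le> 0")
    case False
    then obtain g where "N = int (Suc g)" by (metis gr0_conv_Suc not_le pos_int_cases)
    then show ?thesis using two_row_det_diagonal[of M g] by (simp add: nat_add_distrib)
  qed simp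
next
  case (Suc i)
  show ?case
  proof (cases "N \<le> 0")
    case True
    then show ?thesis using Suc by (simp add: backward_diff_def)
  next
    case False
    then obtain g where g: "N = int (Suc g)" by (metis gr0_conv_Suc not_le pos_int_cases)
    obtain s where s: "M = i + s" using Suc.prems le_Suc_ex by auto
    \<comment> \<open>For \<open>g = 0\<close> the induction hypothesis is in its zero branch, and
      the binomial vanishes too since \<open>s < 2 * M + 1 - i\<close>.\<close>
    have "real_of_int ((backward_diff ^^ i) (relaxed_count (Suc M)) (N - 1) 0)
      = catalan (Suc M) * real ((g + s) choose (2 * M + 1 - i))"
      using Suc by (subst Suc.IH) (auto simp: g s)
    moreover have "real_of_int ((backward_diff ^^ i) (relaxed_count (Suc M)) N 0)
      = catalan (Suc M) * real (Suc (g + s) choose (2 * M + 1 - i))"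
      using Suc by (subst Suc.IH) (auto simp: g s nat_add_distrib)
    moreover have "2 * M + 1 - i = Suc (2 * M + 1 - Suc i)" using s by simp
    moreover have "nat N + M - Suc i = g + s" using g s by (simp add: nat_add_distrib)
    ultimately show ?thesis using False
      by (simp add: backward_diff_def[of "(backward_diff ^^ i) (relaxed_count (Suc M))"] algebra_simps
          del: relaxed_count.simps)
  qed
qed

section \<open>Lists of column heights\<close>

text \<open>The truncated subtraction on \<open>nat\<close> is intended: it computes the positive part.\<close>

definition upward_variation :: "nat list \<Rightarrow> nat" where
  "upward_variation hs = hs ! 0 + (\<Sum>i<length hs - 1. hs ! Suc i + 1 - hs ! i)"

definition height_lists :: "nat \<Rightarrow> nat \<Rightarrow> nat \<Rightarrow> nat list set" where
  "height_lists m n k = {hs. length hs = m \<and> (\<forall>i<m - 1. 2 \<le> hs ! i) \<and>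
     hs ! (m - 1) = k \<and> upward_variation hs = n}"

section \<open>Recursion on the last height\<close>

lemma upward_variation_snoc:
  assumes "gs \<noteq> []"
  shows "upward_variation (gs @ [k]) = upward_variation gs + (k + 1 - gs ! (length gs - 1))"
proof -
  obtain m where m: "length gs = Suc m" using assms by (cases gs) auto
  have "(\<Sum>i<m. (gs @ [k]) ! Suc i + 1 - (gs @ [k]) ! i) = (\<Sum>i<m. gs ! Suc i + 1 - gs ! i)"
    by (intro sum.cong) (auto simp: nth_append m)
  then show ?thesis using m by (simp add: upward_variation_def nth_append)
qed

text \<open>Appending \<open>k\<close> adds at least \<open>k + 1\<close> minus the previous entry,
  so the bound propagates. It confines the entry before the last to \<open>{2..n}\<close>.\<close>

lemma last_le_upward_variation: "hs \<noteq> [] \<Longrightarrow> hs ! (length hs - 1) \<le> upward_variation hs"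
proof (induction hs rule: rev_induct)
  case (snoc k gs)
  show ?case
  proof (cases "gs = []")
    case False
    then show ?thesis using snoc upward_variation_snoc[of gs k] by simp
  qed (simp add: upward_variation_def)
qed simp

lemma height_lists_1: "height_lists 1 n k = (if n = k then {[k]} else {})"
  by (auto simp: height_lists_def upward_variation_def length_Suc_conv)

lemma height_lists_Suc:
  assumes "1 \<le> m" 
  shows "height_lists (Suc m) n k = (\<Union>j\<in>{2..n}. (\<lambda>gs. gs @ [k]) ` height_lists m (n - (k + 1 - j)) j)"
    (is "?L = ?R")
proof (intro set_eqI iffI)
  fix hs assume hs: "hs \<in> ?L"
  then obtain gs k' where gs: "hs = gs @ [k']" "length gs = m"
    by (auto simp: height_lists_def length_Suc_conv_rev)
  have k': "k' = k" using hs gs by (auto simp: height_lists_def nth_append)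
  define j where "j = gs ! (m - 1)"
  have ne: "gs \<noteq> []" using gs assms by auto
  have n: "n = upward_variation gs + (k + 1 - j)"
    using hs gs upward_variation_snoc[OF ne, of k] by (auto simp: height_lists_def j_def k')
  have lo: "2 \<le> gs ! i" if "i < m" for i
    using hs gs that by (auto simp: height_lists_def nth_append split: if_splits)
  have "j \<in> {2..n}"
    using n last_le_upward_variation[OF ne] lo[of "m - 1"] assms gs by (auto simp: j_def)
  moreover have "gs \<in> height_lists m (n - (k + 1 - j)) j"
    using n gs lo by (auto simp: height_lists_def j_def)
  ultimately show "hs \<in> ?R" using gs k' by auto
next
  fix hs assume "hs \<in> ?R"
  then obtain j gs where j: "2 \<le> j" "j \<le> n" and hs: "hs = gs @ [k]" and gs: "gs \<in> height_lists m (n - (k + 1 - j)) j"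
    by auto
  have ne: "gs \<noteq> []" and len: "length gs = m" using gs assms by (auto simp: height_lists_def)
  have gj: "gs ! (m - 1) = j" "upward_variation gs = n - (k + 1 - j)" using gs by (auto simp: height_lists_def)
  \<comment> \<open>Otherwise \<open>n - (k + 1 - j)\<close> would truncate to 0, below the last
    entry \<open>j \<ge> 2\<close> of \<open>gs\<close>.\<close>
  have "k + 1 - j \<le> n" using last_le_upward_variation[OF ne] len gj j by auto
  then have "upward_variation hs = n"
    using upward_variation_snoc[OF ne, of k] gj len hs by simp
  moreover have "2 \<le> hs ! i" if "i < m" for i
  proof (cases "i = m - 1")
    case True
    then show ?thesis using gj j len that hs by (simp add: nth_append)
  next
    case False
    then show ?thesis using gs len that hs by (auto simp: nth_append height_lists_def)
  qed
  ultimately show "hs \<in> ?L" using len hs by (auto simp: height_lists_def nth_append)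
qed

lemma finite_height_lists: "1 \<le> m \<Longrightarrow> finite (height_lists m n k)"
proof (induction m arbitrary: n k)
  case (Suc m)
  then show ?case
    by (cases "m = 0") (auto simp: height_lists_1[unfolded One_nat_def] height_lists_Suc)
qed simp

lemma card_height_lists_Suc:
  assumes "1 \<le> m"
  shows "card (height_lists (Suc m) n k) = (\<Sum>j\<in>{2..n}. card (height_lists m (n - (k + 1 - j)) j))"
proof -
  have "card (height_lists (Suc m) n k)
     = (\<Sum>j\<in>{2..n}. card ((\<lambda>gs. gs @ [k]) ` height_lists m (n - (k + 1 - j)) j))"
    unfolding height_lists_Suc[OF assms]
    by (rule card_UN_disjoint) (simp, blast intro: finite_height_lists[OF assms], auto simp: height_lists_def)
  also have "\<dots> = (\<Sum>j\<in>{2..n}. card (height_lists m (n - (k + 1 - j)) j))"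
    by (intro sum.cong refl card_image) (auto simp: inj_on_def)
  finally show ?thesis .
qed

text \<open>Induction by \<open>height_lists_Suc\<close>, which is \<open>transfer\<close> after
  lowering \<open>n\<close> and all heights by one. \<open>transfer\<close> commutes with the
  \<open>i\<close> differences, and \<open>backward_diff_relaxed_count\<close> supplies one
  more.\<close>

lemma card_height_lists:
  assumes "1 \<le> k"
  shows "int (card (height_lists (Suc i) n k))
    = (backward_diff ^^ i) (relaxed_count i) (int n - 1) (int k - 1)"
  using assms
proof (induction i arbitrary: n k)
  case 0
  then show ?case by (simp add: height_lists_1[unfolded One_nat_def])
next
  case (Suc i)
  let ?a = "(backward_diff ^^ i) (relaxed_count i)"
  have a0: "?a N j = 0" if "N < j" for N j
    using that by (intro backward_diff_funpow_eq_0 relaxed_count_eq_0)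
  have "int (card (height_lists (Suc (Suc i)) n k))
     = (\<Sum>j\<in>{2..n}. ?a (int (n - (k + 1 - j)) - 1) (int j - 1))"
    using Suc by (simp add: card_height_lists_Suc)
  also have "\<dots> = (\<Sum>j\<in>{1..int n - 1}. ?a (int n - 1 - max 0 (int k - 1 + 1 - j)) j)"
  proof (rule sum.reindex_bij_witness[where i = "\<lambda>j. nat (j + 1)" and j = "\<lambda>j. int j - 1"])
    fix j assume j: "j \<in> {2..n}"
    show "?a (int n - 1 - max 0 (int k - 1 + 1 - (int j - 1))) (int j - 1)
       = ?a (int (n - (k + 1 - j)) - 1) (int j - 1)"
    proof (cases "k + 1 - j \<le> n")
      case True
      then have "int n - 1 - max 0 (int k - 1 + 1 - (int j - 1)) = int (n - (k + 1 - j)) - 1" by linarith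
      then show ?thesis by (simp only:)
    next
      case False
      \<comment> \<open>Truncated and genuine subtraction give different negative arguments, but
        both lie below \<open>int j - 1\<close>, where the count is 0.\<close>
      then show ?thesis using j by (subst (1 2) a0) auto
    qed
  qed auto
  also have "\<dots> = transfer ?a (int n - 1) (int k - 1)"
    using Suc.prems by (simp add: transfer_def)
  also have "transfer ?a = (backward_diff ^^ Suc i) (relaxed_count (Suc i))"
    by (subst transfer_backward_diff_funpow)
       (simp_all add: relaxed_count_eq_0 backward_diff_relaxed_count[symmetric] funpow_swap1)
  finally show ?case .
qed

text \<open>Last height 1 is last term 0; with \<open>N = n - 1\<close> the \<open>M + 1\<close>
  differences lower \<open>(N + M) choose (2 * M + 1)\<close> to
  \<open>(n - 2) choose M\<close>.\<close>

lemma card_height_lists_last_1: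
  assumes "2 \<le> n"
  shows "real (card (height_lists (Suc (Suc M)) n 1)) = catalan (Suc M) * real ((n - 2) choose M)"
proof -
  have "real (card (height_lists (Suc (Suc M)) n 1)) = real_of_int (int (card (height_lists (Suc (Suc M)) n 1)))"
    by simp
  also have "\<dots> = real_of_int ((backward_diff ^^ Suc M) (relaxed_count (Suc M)) (int n - 1) 0)"
    by (subst card_height_lists) simp_all
  also have "\<dots> = catalan (Suc M) * real ((n - 2) choose M)"
    using assms by (subst iterated_backward_diff_relaxed_count_0) (auto simp: nat_diff_distrib)
  finally show ?thesis .
qed

section \<open>Fibonacci polyominoes and their column heights\<close>

definition staircase_heights :: "nat list \<Rightarrow> bool" where
  "staircase_heights hs \<longleftrightarrow> hs \<noteq> [] \<and> (\<forall>i<length hs - 1. 2 \<le> hs ! i) \<and> 1 \<le> hs ! (length hs - 1)"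

definition staircase :: "nat list \<Rightarrow> cell set" where
  "staircase hs = {(x, y). 0 \<le> x \<and> x < int (length hs) \<and> x \<le> y \<and> y < x + int (hs ! nat x)}"

section \<open>Staircases are Fibonacci polyominoes\<close>

lemma staircase_heights_pos:
  assumes "staircase_heights hs" "i < length hs"
  shows "1 \<le> hs ! i"
proof (cases "i = length hs - 1")
  case False
  then have "2 \<le> hs ! i" using assms by (auto simp: staircase_heights_def)
  then show ?thesis by simp
qed (use assms in \<open>auto simp: staircase_heights_def\<close>)

lemma column_staircase:
  "column (staircase hs) x = (if 0 \<le> x \<and> x < int (length hs) then {x..<x + int (hs ! nat x)} else {})"
  by (auto simp: column_def staircase_def)

lemma fst_staircase:
  assumes "staircase_heights hs"
  shows "fst ` staircase hs = {0..<int (length hs)}"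
proof
  show "{0..<int (length hs)} \<subseteq> fst ` staircase hs"
  proof
    fix x assume x: "x \<in> {0..<int (length hs)}"
    then have "1 \<le> hs ! nat x" by (intro staircase_heights_pos[OF assms]) auto
    then have "(x, x) \<in> staircase hs" using x by (auto simp: staircase_def)
    then show "x \<in> fst ` staircase hs" by force
  qed
qed (auto simp: staircase_def)

lemma staircase_heights_length_pos: "staircase_heights hs \<Longrightarrow> 0 < length hs"
  by (simp add: staircase_heights_def)

lemma finite_staircase: "finite (staircase hs)"
proof (rule finite_subset)
  show "staircase hs \<subseteq> (SIGMA x:{0..<int (length hs)}. {x..<x + int (hs ! nat x)})"
    by (auto simp: staircase_def)
qed auto

text \<open>Within a column one climbs. Height at least 2 puts the cell \<open>(i, i + 1)\<close>
  beside the bottom cell of column \<open>i + 1\<close>, and the path crosses there.\<close>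

lemma staircase_reachable:
  assumes hs: "staircase_heights hs"
  shows "i < length hs \<Longrightarrow> t < hs ! i \<Longrightarrow>
    ((0, 0), (int i, int (i + t))) \<in> {(a, b). a \<in> staircase hs \<and> b \<in> staircase hs \<and> adjacent a b}\<^sup>*"
    (is "_ \<Longrightarrow> _ \<Longrightarrow> _ \<in> ?R\<^sup>*")
proof (induction i arbitrary: t)
  case 0
  then show ?case
  proof (induction t)
    case (Suc t)
    have "((int 0, int (0 + t)), (int 0, int (0 + Suc t))) \<in> ?R"
      using Suc.prems by (auto simp: staircase_def adjacent_def)
    then show ?case using Suc by (meson Suc_lessD rtrancl.rtrancl_into_rtrancl)
  qed simp
next
  case (Suc i)
  have two: "2 \<le> hs ! i" using hs Suc.prems by (auto simp: staircase_heights_def)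
  show ?case using Suc.prems
  proof (induction t)
    case 0
    have "((int i, int (i + 1)), (int (Suc i), int (Suc i + 0))) \<in> ?R"
      using 0 two by (auto simp: staircase_def adjacent_def nat_add_distrib)
    moreover have "((0, 0), (int i, int (i + 1))) \<in> ?R\<^sup>*"
      using 0 two by (intro Suc.IH) auto
    ultimately show ?case by (meson rtrancl.rtrancl_into_rtrancl)
  next
    case (Suc t)
    have "((int (Suc i), int (Suc i + t)), (int (Suc i), int (Suc i + Suc t))) \<in> ?R"
      using Suc.prems by (auto simp: staircase_def adjacent_def nat_add_distrib)
    then show ?case using Suc by (meson Suc_lessD rtrancl.rtrancl_into_rtrancl)
  qed
qed

lemma fibonacci_polyomino_staircase:
  assumes hs: "staircase_heights hs"
  shows "fibonacci_polyomino (staircase hs)"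
proof -
  let ?R = "{(a, b). a \<in> staircase hs \<and> b \<in> staircase hs \<and> adjacent a b}"
  have sym: "sym (?R\<^sup>*)" by (rule sym_rtrancl) (auto simp: sym_def adjacent_def)
  have reach: "((0, 0), c) \<in> ?R\<^sup>*" if mem: "c \<in> staircase hs" for c
  proof -
    obtain x y where c: "c = (x, y)" "0 \<le> x" "x < int (length hs)" "x \<le> y" "y < x + int (hs ! nat x)"
      using mem by (auto simp: staircase_def)
    then show ?thesis using staircase_reachable[OF hs, of "nat x" "nat (y - x)"] by simp
  qed
  have conn: "(c, d) \<in> ?R\<^sup>*" if "c \<in> staircase hs" "d \<in> staircase hs" for c d
    using reach[OF that(1)] reach[OF that(2)] sym by (meson rtrancl_trans symD)
  have ne: "staircase hs \<noteq> {}"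
    using fst_staircase[OF hs] staircase_heights_length_pos[OF hs] by auto
  have convex: "column_convex (staircase hs)"
    unfolding column_convex_def
  proof
    fix x
    have "{x..<x + int (hs ! nat x)} = {x..x + int (hs ! nat x) - 1}" by auto
    \<comment> \<open>\<open>column_convex\<close> asks for an interval at every position, so empty
      columns take an empty one as witness.\<close>
    moreover have "{} = {1..0::int}" by simp
    ultimately show "\<exists>a b. column (staircase hs) x = {a..b}" unfolding column_staircase by metis
  qed
  have "Min {x..<x + int h} = x" if "{x..<x + int h} \<noteq> {}" for x h
    using that by (intro Min_eqI) auto
  then have "Min (column (staircase hs) x) = x" if "column (staircase hs) x \<noteq> {}" for x
    using that by (auto simp: column_staircase split: if_splits)
  then show ?thesis
    unfolding fibonacci_polyomino_def polyomino_def
    using conn ne convex finite_staircase by auto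
qed

section \<open>Boundary edges as differences of membership\<close>

lemma ex1_pair_iff: "a \<noteq> b \<Longrightarrow> (\<exists>!c. c \<in> P \<and> (c = a \<or> c = b)) \<longleftrightarrow> (a \<in> P) \<noteq> (b \<in> P)"
  by metis

text \<open>A horizontal unit edge lies only on the cells directly above and below it, so exactly
  one of them must be present.\<close>

lemma horizontal_boundary_iff:
  "(\<exists>!c. c \<in> P \<and> (x, y) \<in> horizontal_edges c) \<longleftrightarrow> ((x, y) \<in> P) \<noteq> ((x, y - 1) \<in> P)"
proof -
  have "(x, y) \<in> horizontal_edges c \<longleftrightarrow> c = (x, y) \<or> c = (x, y - 1)" for c
    by (cases c) (auto simp: horizontal_edges_def)
  then show ?thesis using ex1_pair_iff[of "(x, y)" "(x, y - 1)" P] by simp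
qed

lemma vertical_boundary_iff:
  "(\<exists>!c. c \<in> P \<and> (x, y) \<in> vertical_edges c) \<longleftrightarrow> ((x, y) \<in> P) \<noteq> ((x - 1, y) \<in> P)"
proof -
  have "(x, y) \<in> vertical_edges c \<longleftrightarrow> c = (x, y) \<or> c = (x - 1, y)" for c
    by (cases c) (auto simp: vertical_edges_def)
  then show ?thesis using ex1_pair_iff[of "(x, y)" "(x - 1, y)" P] by simp
qed

lemma horizontal_semiperimeter_alt:
  "horizontal_semiperimeter P = real (card {(x, y). ((x, y) \<in> P) \<noteq> ((x, y - 1) \<in> P)}) / 2"
proof -
  have "{e. \<exists>!c. c \<in> P \<and> e \<in> horizontal_edges c} = {(x, y). ((x, y) \<in> P) \<noteq> ((x, y - 1) \<in> P)}"
    by (intro set_eqI) (simp only: horizontal_boundary_iff mem_Collect_eq split_paired_all prod.case)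
  then show ?thesis by (simp only: horizontal_semiperimeter_def)
qed

lemma vertical_semiperimeter_alt:
  "vertical_semiperimeter P = real (card {(x, y). ((x, y) \<in> P) \<noteq> ((x - 1, y) \<in> P)}) / 2"
proof -
  have "{e. \<exists>!c. c \<in> P \<and> e \<in> vertical_edges c} = {(x, y). ((x, y) \<in> P) \<noteq> ((x - 1, y) \<in> P)}"
    by (intro set_eqI) (simp only: vertical_boundary_iff mem_Collect_eq split_paired_all prod.case)
  then show ?thesis by (simp only: vertical_semiperimeter_def)
qed

section \<open>Invariance under translation\<close>

lemma mem_translate: "(x, y) \<in> translate v P \<longleftrightarrow> (x - fst v, y - snd v) \<in> P"
  by (force simp: translate_def)

lemma card_translate: "card (translate v P) = card P"
  unfolding translate_def by (rule card_image) (auto simp: inj_on_def)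

lemma horizontal_semiperimeter_translate:
  "horizontal_semiperimeter (translate v P) = horizontal_semiperimeter P"
proof -
  have "{(x, y). ((x, y) \<in> translate v P) \<noteq> ((x, y - 1) \<in> translate v P)}
      = translate v {(x, y). ((x, y) \<in> P) \<noteq> ((x, y - 1) \<in> P)}"
    by (auto simp: mem_translate algebra_simps)
  then show ?thesis by (simp only: horizontal_semiperimeter_alt card_translate)
qed

lemma vertical_semiperimeter_translate:
  "vertical_semiperimeter (translate v P) = vertical_semiperimeter P"
proof -
  have "{(x, y). ((x, y) \<in> translate v P) \<noteq> ((x - 1, y) \<in> translate v P)}
      = translate v {(x, y). ((x, y) \<in> P) \<noteq> ((x - 1, y) \<in> P)}"
    by (auto simp: mem_translate algebra_simps)
  then show ?thesis by (simp only: vertical_semiperimeter_alt card_translate)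
qed

lemma column_translate: "column (translate v P) x = (+) (snd v) ` column P (x - fst v)"
  by (force simp: column_def mem_translate image_iff)

lemma fst_translate: "fst ` translate v P = (+) (fst v) ` fst ` P"
  by (force simp: translate_def image_image)

lemma last_column_height_translate:
  assumes "finite P" "P \<noteq> {}"
  shows "last_column_height (translate v P) = last_column_height P"
proof -
  have "Max (fst ` translate v P) = fst v + Max (fst ` P)"
    unfolding fst_translate using assms
    by (intro mono_Max_commute[symmetric]) (auto simp: mono_def)
  then show ?thesis
    by (simp add: last_column_height_def column_translate card_image)
qed

section \<open>Semiperimeters of a staircase\<close>

lemma horizontal_semiperimeter_staircase:
  assumes hs: "staircase_heights hs"
  shows "horizontal_semiperimeter (staircase hs) = real (length hs)"
proof -
  let ?I = "{0..<int (length hs)}"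
  let ?A = "(\<lambda>x. (x, x)) ` ?I" and ?B = "(\<lambda>x. (x, x + int (hs ! nat x))) ` ?I"
  have pos: "1 \<le> hs ! nat x" if "x \<in> ?I" for x
    using that by (intro staircase_heights_pos[OF hs]) auto
  have "{(x, y). ((x, y) \<in> staircase hs) \<noteq> ((x, y - 1) \<in> staircase hs)} = ?A \<union> ?B"
  proof -
    have "((x, y) \<in> staircase hs) \<noteq> ((x, y - 1) \<in> staircase hs)
        \<longleftrightarrow> x \<in> ?I \<and> (y = x \<or> y = x + int (hs ! nat x))" for x y
      using pos[of x] by (auto simp: staircase_def)
    then show ?thesis by auto
  qed
  moreover have "?A \<inter> ?B = {}" using pos by fastforce
  moreover have "card ?A = length hs" "card ?B = length hs"
    by (subst card_image; simp add: inj_on_def)+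
  ultimately have "card {(x, y). ((x, y) \<in> staircase hs) \<noteq> ((x, y - 1) \<in> staircase hs)} = 2 * length hs"
    by (simp add: card_Un_disjoint)
  then show ?thesis by (simp add: horizontal_semiperimeter_alt)
qed

text \<open>The boundary between neighbouring columns consists of row \<open>x\<close> and the gap
  between the tops, \<open>1 + \<bar>b + 1 - a\<bar>\<close> edges. Expressed by the truncated
  positive part, it leaves \<open>a - b\<close>, which telescopes.\<close>

lemma card_sym_diff_columns:
  fixes x :: int and a b :: nat
  assumes "1 \<le> a"
  shows "int (card (({x + 1..<x + 1 + int b} - {x..<x + int a}) \<union> ({x..<x + int a} - {x + 1..<x + 1 + int b})))
     = 2 * int (b + 1 - a) + int a - int b"
proof (cases "a \<le> b + 1")
  case True
  have "({x + 1..<x + 1 + int b} - {x..<x + int a}) \<union> ({x..<x + int a} - {x + 1..<x + 1 + int b})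
      = insert x {x + int a..<x + 1 + int b}"
    using True assms by auto
  then show ?thesis using True assms by (simp add: of_nat_diff)
next
  case False
  have "({x + 1..<x + 1 + int b} - {x..<x + int a}) \<union> ({x..<x + int a} - {x + 1..<x + 1 + int b})
      = insert x {x + 1 + int b..<x + int a}"
    using False assms by auto
  then show ?thesis using False assms by simp
qed

lemma vertical_semiperimeter_staircase:
  assumes hs: "staircase_heights hs"
  shows "vertical_semiperimeter (staircase hs) = real (upward_variation hs)"
proof -
  obtain l where l: "length hs = Suc l" using staircase_heights_length_pos[OF hs] gr0_conv_Suc by blast
  \<comment> \<open>Rows of the vertical boundary edges at abscissa \<open>x\<close>; at
    \<open>0\<close> and \<open>l + 1\<close> one of the two columns is empty.\<close>
  define D where "D x = (column (staircase hs) x - column (staircase hs) (x - 1)) \<union>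
     (column (staircase hs) (x - 1) - column (staircase hs) x)" for x
  have D_outside: "D x = {}" if "x \<notin> {0..int l + 1}" for x
    using that by (auto simp: D_def column_staircase l)
  have D_fin: "finite (D x)" for x by (simp add: D_def column_staircase)
  have "{(x, y). ((x, y) \<in> staircase hs) \<noteq> ((x - 1, y) \<in> staircase hs)} = (SIGMA x:{0..int l + 1}. D x)"
    using D_outside by (fastforce simp: D_def column_def)
  then have "card {(x, y). ((x, y) \<in> staircase hs) \<noteq> ((x - 1, y) \<in> staircase hs)}
     = (\<Sum>x\<in>{0..int l + 1}. card (D x))"
    by (simp add: card_SigmaI D_fin)
  also have "\<dots> = (\<Sum>i\<le>Suc l. card (D (int i)))"
    by (rule sum.reindex_bij_witness[where i = int and j = nat]) auto
  also have "\<dots> = card (D 0) + (\<Sum>i<l. card (D (int i + 1))) + card (D (int l + 1))"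
    unfolding lessThan_Suc_atMost[symmetric] by (subst sum.lessThan_Suc_shift) (simp add: add.commute)
  finally have "int (card {(x, y). ((x, y) \<in> staircase hs) \<noteq> ((x - 1, y) \<in> staircase hs)})
     = int (card (D 0)) + (\<Sum>i<l. int (card (D (int i + 1)))) + int (card (D (int l + 1)))"
    by simp
  also have "(\<Sum>i<l. int (card (D (int i + 1))))
     = (\<Sum>i<l. 2 * int (hs ! Suc i + 1 - hs ! i) - (int (hs ! Suc i) - int (hs ! i)))"
  proof (rule sum.cong[OF refl])
    fix i assume "i \<in> {..<l}"
    then have i: "i < l" by simp
    have "1 \<le> hs ! i" using i l by (intro staircase_heights_pos[OF hs]) simp
    moreover have "D (int i + 1) = ({int i + 1..<int i + 1 + int (hs ! Suc i)} - {int i..<int i + int (hs ! i)})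
       \<union> ({int i..<int i + int (hs ! i)} - {int i + 1..<int i + 1 + int (hs ! Suc i)})"
      using i l by (simp add: D_def column_staircase nat_add_distrib)
    ultimately show "int (card (D (int i + 1))) = 2 * int (hs ! Suc i + 1 - hs ! i) - (int (hs ! Suc i) - int (hs ! i))"
      by (simp only: card_sym_diff_columns)
  qed
  \<comment> \<open>The signed parts telescope to the difference of the outer heights, which the
    contributions of \<open>D 0\<close> and \<open>D (int l + 1)\<close> complete to
    \<open>2 * hs ! 0\<close>.\<close>
  also have "\<dots> = 2 * int (\<Sum>i<l. hs ! Suc i + 1 - hs ! i) - (int (hs ! l) - int (hs ! 0))"
  proof -
    have "(\<Sum>i<l. int (hs ! Suc i) - int (hs ! i)) = int (hs ! l) - int (hs ! 0)"
      by (rule sum_lessThan_telescope)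
    then show ?thesis
      unfolding sum_subtractf[of "\<lambda>i. 2 * int (hs ! Suc i + 1 - hs ! i)"]
      by (simp only: sum_distrib_left[symmetric] of_nat_sum)
  qed
  also have "D 0 = {0..<int (hs ! 0)}" by (simp add: D_def column_staircase l)
  also have "D (int l + 1) = {int l..<int l + int (hs ! l)}" by (simp add: D_def column_staircase l)
  finally have "int (card {(x, y). ((x, y) \<in> staircase hs) \<noteq> ((x - 1, y) \<in> staircase hs)})
     = int (2 * upward_variation hs)"
    by (simp add: upward_variation_def l)
  then show ?thesis unfolding vertical_semiperimeter_alt of_nat_eq_iff by simp
qed

lemma last_column_height_staircase:
  assumes hs: "staircase_heights hs"
  shows "last_column_height (staircase hs) = hs ! (length hs - 1)"
proof -
  have pos: "0 < length hs" using hs by (rule staircase_heights_length_pos)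
  have "Max (fst ` staircase hs) = int (length hs) - 1"
    unfolding fst_staircase[OF hs] using pos by (intro Max_eqI) auto
  moreover have "nat (int (length hs) - 1) = length hs - 1" by simp
  ultimately show ?thesis using pos by (simp add: last_column_height_def column_staircase)
qed

text \<open>Projecting to column positions forces a zero horizontal shift; column cardinalities,
  blind to the vertical shift, then give the heights.\<close>

lemma staircase_translate_inj:
  assumes hs: "staircase_heights hs" and hs': "staircase_heights hs'"
    and eq: "staircase hs' = translate v (staircase hs)"
  shows "hs' = hs"
proof -
  have pos: "0 < length hs" "0 < length hs'" using hs hs' by (simp_all only: staircase_heights_length_pos)
  have "{0..<int (length hs')} = {fst v..<fst v + int (length hs)}"
    using fst_translate[of v "staircase hs"] eq fst_staircase[OF hs] fst_staircase[OF hs']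
    by (simp add: image_add_atLeastLessThan add.commute)
  then have v1: "fst v = 0" and len: "length hs' = length hs"
    using pos by (auto simp: atLeastLessThan_eq_iff)
  have col: "{x..<x + int (hs' ! nat x)} = {snd v + x..<snd v + x + int (hs ! nat x)}"
    if "0 \<le> x" "x < int (length hs)" for x
    using column_translate[of v "staircase hs" x, folded eq] that len v1
    by (simp add: column_staircase image_add_atLeastLessThan add_ac)
  show ?thesis
  proof (rule nth_equalityI[OF len])
    fix i assume "i < length hs'"
    then have "card {int i..<int i + int (hs' ! i)} = card {snd v + int i..<snd v + int i + int (hs ! i)}"
      using col[of "int i"] len by simp
    then show "hs' ! i = hs ! i" by simp
  qed
qed

text \<open>On a path from \<open>c\<close> to \<open>d\<close>, a step that leaves the half-plane
  up to column \<open>x\<close> must be horizontal, so it stays in one row.\<close>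

lemma polyomino_crossing:
  assumes P: "polyomino P" and c: "c \<in> P" "fst c \<le> x" and d: "d \<in> P" "x < fst d"
  obtains y where "(x, y) \<in> P" "(x + 1, y) \<in> P"
proof -
  have "(c, d) \<in> {(a, b). a \<in> P \<and> b \<in> P \<and> adjacent a b}\<^sup>*"
    using P c d by (auto simp: polyomino_def)
  then have "fst d \<le> x \<or> (\<exists>y. (x, y) \<in> P \<and> (x + 1, y) \<in> P)"
  proof (induction rule: rtrancl_induct)
    case base
    then show ?case using c by simp
  next
    case (step a b)
    obtain a1 a2 b1 b2 where ab: "a = (a1, a2)" "b = (b1, b2)" by fastforce
    show ?case
    proof (cases "fst a \<le> x \<and> x < fst b")
      case True
      then have "a1 = x" "b1 = x + 1" "a2 = b2" using step(2) ab by (auto simp: adjacent_def)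
      then show ?thesis using step(2) ab by auto
    qed (use step(3) in auto)
  qed
  then show thesis using d that by auto
qed

text \<open>By \<open>polyomino_crossing\<close>, all columns between the extreme ones are nonempty
  and neighbours share a row. The bottoms then climb by one from \<open>(a, c)\<close>, and the
  heights determine \<open>P\<close>.\<close>

lemma fibonacci_polyomino_obtain_staircase:
  assumes F: "fibonacci_polyomino P"
  obtains hs v where "staircase_heights hs" "P = translate v (staircase hs)"
proof -
  have P: "polyomino P" and conv: "column_convex P"
    and step: "\<And>i. column P i \<noteq> {} \<Longrightarrow> column P (i + 1) \<noteq> {} \<Longrightarrow> Min (column P (i + 1)) = Min (column P i) + 1"
    using F by (auto simp: fibonacci_polyomino_def)
  have fin: "finite (fst ` P)" and ne: "fst ` P \<noteq> {}" using P by (auto simp: polyomino_def)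
  define a b where "a = Min (fst ` P)" and "b = Max (fst ` P)"
  have ab: "a \<in> fst ` P" "b \<in> fst ` P" "\<And>x y. (x, y) \<in> P \<Longrightarrow> a \<le> x \<and> x \<le> b"
    using Min_in[OF fin ne] Max_in[OF fin ne] Min_le[OF fin] Max_ge[OF fin]
    unfolding a_def b_def by force+
  have cross: "\<exists>y. (x, y) \<in> P \<and> (x + 1, y) \<in> P" if "a \<le> x" "x < b" for x
    using polyomino_crossing[OF P] ab(1,2) that by (metis imageE)
  have nonempty: "column P x \<noteq> {}" if "a \<le> x" "x \<le> b" for x
  proof (cases "x = b")
    case True
    then show ?thesis using ab(2) by (auto simp: column_def)
  next
    case False
    then show ?thesis using cross[of x] that by (auto simp: column_def)
  qed
  define c where "c = Min (column P a)"
  have mins: "a + int i \<le> b \<Longrightarrow> Min (column P (a + int i)) = c + int i" for i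
  proof (induction i)
    case (Suc i)
    then have "Min (column P (a + int i + 1)) = Min (column P (a + int i)) + 1"
      by (intro step nonempty) auto
    then show ?case using Suc by (simp add: add.assoc add.commute[of 1])
  qed (simp add: c_def)
  define m where "m = nat (b - a + 1)"
  define hs where "hs = map (\<lambda>i. card (column P (a + int i))) [0..<m]"
  have "a \<le> b" using ab by (metis imageE prod.collapse)
  then have m: "int m = b - a + 1" "0 < m" by (simp_all add: m_def)
  have cols: "column P (a + int i) = {c + int i..<c + int i + int (hs ! i)}" and hpos: "1 \<le> hs ! i" if "i < m" for i
  proof -
    obtain l u where lu: "column P (a + int i) = {l..u}" using conv unfolding column_convex_def by blast
    have "l \<le> u" using nonempty[of "a + int i"] lu that m by auto
    then have "Min {l..u} = l" by (intro Min_eqI) auto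
    then have "l = c + int i" using mins[of i] lu that m by simp
    moreover have "hs ! i = card {l..u}" using lu that by (simp add: hs_def)
    ultimately show "column P (a + int i) = {c + int i..<c + int i + int (hs ! i)}" "1 \<le> hs ! i"
      using lu \<open>l \<le> u\<close> by auto
  qed
  have "2 \<le> hs ! i" if i: "i < m - 1" for i
  proof -
    have less: "a + int i < b" using i m by linarith
    \<comment> \<open>The shared row is at least the bottom of column \<open>i + 1\<close>, hence
      strictly above that of column \<open>i\<close>, so column \<open>i\<close> has two
      cells.\<close>
    obtain y where "(a + int i, y) \<in> P" "(a + int i + 1, y) \<in> P"
      using cross[of "a + int i"] less by auto
    then have "y \<in> column P (a + int i)" "y \<in> column P (a + int (Suc i))"
      by (auto simp: column_def algebra_simps)
    then show ?thesis using cols[of i] cols[of "Suc i"] i by auto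
  qed
  then have "staircase_heights hs"
    using hpos[of "m - 1"] m by (auto simp: staircase_heights_def hs_def)
  moreover have "P = translate (a, c) (staircase hs)"
  proof -
    have len: "length hs = m" by (simp add: hs_def)
    have "(x, y) \<in> P \<longleftrightarrow> (x - a, y - c) \<in> staircase hs" for x y
    proof (cases "a \<le> x \<and> x \<le> b")
      case True
      define i where "i = nat (x - a)"
      have i: "x = a + int i" "i < m" using True m by (auto simp: i_def)
      have "(x, y) \<in> P \<longleftrightarrow> y \<in> column P (a + int i)" by (simp add: column_def i)
      also have "\<dots> \<longleftrightarrow> (x - a, y - c) \<in> staircase hs"
        using cols[OF i(2)] i len by (auto simp: staircase_def)
      finally show ?thesis .
    next
      case False
      then show ?thesis using ab(3)[of x y] m len by (auto simp: staircase_def)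
    qed
    then show ?thesis by (auto simp: mem_translate)
  qed
  ultimately show thesis by (rule that)
qed

text \<open>The predicate \<open>R\<close> on the last height lets one statement serve the full
  count and both refined counts.\<close>

lemma bij_betw_fib_polyominoes:
  "bij_betw (\<lambda>hs. translation_rel `` {staircase hs})
     {hs. staircase_heights hs \<and> length hs = m \<and> upward_variation hs = n \<and> R (hs ! (length hs - 1))}
     ({P \<in> fib_polyominoes m n. R (last_column_height P)} // translation_rel)"
  (is "bij_betw ?f ?H (?X // _)")
proof (rule bij_betw_imageI)
  show "inj_on ?f ?H"
  proof (rule inj_onI)
    fix hs hs' assume h: "hs \<in> ?H" "hs' \<in> ?H" and eq: "?f hs = ?f hs'"
    have "(staircase hs, staircase hs') \<in> translation_rel"
      using eq equiv_translation_rel by (metis UNIV_I eq_equiv_class)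
    then obtain v where "staircase hs' = translate v (staircase hs)" by (auto simp: translation_rel_def)
    then show "hs = hs'" using staircase_translate_inj[of hs hs'] h by auto
  qed
  have in_X: "staircase hs \<in> ?X \<longleftrightarrow> hs \<in> ?H" if "staircase_heights hs" for hs
    using that by (auto simp: fib_polyominoes_def fibonacci_polyomino_staircase horizontal_semiperimeter_staircase
        vertical_semiperimeter_staircase last_column_height_staircase)
  show "?f ` ?H = ?X // translation_rel"
  proof
    show "?f ` ?H \<subseteq> ?X // translation_rel"
      using in_X by (auto intro!: quotientI)
    show "?X // translation_rel \<subseteq> ?f ` ?H"
    proof
      fix C assume "C \<in> ?X // translation_rel"
      then obtain Q where Q: "Q \<in> ?X" "C = translation_rel `` {Q}" by (auto elim: quotientE)
      then obtain hs v where hs: "staircase_heights hs" "Q = translate v (staircase hs)"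
        using fibonacci_polyomino_obtain_staircase[of Q] by (auto simp: fib_polyominoes_def)
      have ne: "staircase hs \<noteq> {}"
        using fst_staircase[OF hs(1)] staircase_heights_length_pos[OF hs(1)] by auto
      have "staircase hs \<in> ?X"
        using Q hs(2) fibonacci_polyomino_staircase[OF hs(1)]
        by (auto simp: fib_polyominoes_def horizontal_semiperimeter_translate vertical_semiperimeter_translate
            last_column_height_translate[OF finite_staircase ne])
      moreover have "C = ?f hs"
        unfolding Q(2) using hs(2)
        by (intro equiv_class_eq[OF equiv_translation_rel, symmetric]) (unfold translation_rel_def, blast)
      ultimately show "C \<in> ?f ` ?H" using in_X[OF hs(1)] by blast
    qed
  qed
qed

text \<open>After a last height \<open>j \<ge> 2\<close>, a further height 1 adds the truncated
  \<open>1 + 1 - j = 0\<close> to the upward variation.\<close>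

lemma height_lists_last_ge_2:
  assumes "1 \<le> m"
  shows "bij_betw (\<lambda>hs. hs @ [1])
     {hs. staircase_heights hs \<and> length hs = m \<and> upward_variation hs = n \<and> 2 \<le> hs ! (length hs - 1)}
     (height_lists (Suc m) n 1)"
proof (rule bij_betw_imageI)
  have "{hs. staircase_heights hs \<and> length hs = m \<and> upward_variation hs = n \<and> 2 \<le> hs ! (length hs - 1)}
      = (\<Union>j\<in>{2..n}. height_lists m n j)"
    (is "?L = ?R")
  proof (intro set_eqI iffI)
    fix hs assume hs: "hs \<in> ?L"
    then have "hs ! (length hs - 1) \<le> n"
      using last_le_upward_variation[of hs] by (auto simp: staircase_heights_def)
    with hs have "hs \<in> height_lists m n (hs ! (length hs - 1))" "hs ! (length hs - 1) \<in> {2..n}"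
      by (auto simp: staircase_heights_def height_lists_def)
    then show "hs \<in> ?R" by blast
  next
    fix hs assume "hs \<in> ?R"
    then show "hs \<in> ?L" using assms by (auto simp: staircase_heights_def height_lists_def)
  qed
  moreover have "height_lists (Suc m) n 1 = (\<Union>j\<in>{2..n}. (\<lambda>hs. hs @ [1]) ` height_lists m n j)"
    unfolding height_lists_Suc[OF assms] by (intro SUP_cong) auto
  ultimately show "(\<lambda>hs. hs @ [1]) ` {hs. staircase_heights hs \<and> length hs = m \<and> upward_variation hs = n \<and> 2 \<le> hs ! (length hs - 1)}
    = height_lists (Suc m) n 1" by (simp add: image_UN)
qed (auto simp: inj_on_def)

lemma height_lists_last_eq_1:
  assumes "1 \<le> m"
  shows "{hs. staircase_heights hs \<and> length hs = m \<and> upward_variation hs = n \<and> hs ! (length hs - 1) = 1}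
    = height_lists m n 1"
  using assms by (auto simp: staircase_heights_def height_lists_def)

section \<open>Counting translation classes by the last column\<close>

lemma fib_polyominoes_last_ge_2:
  assumes "1 \<le> m" "2 \<le> n"
  shows "finite ({P \<in> fib_polyominoes m n. 2 \<le> last_column_height P} // translation_rel)"
    and "real (card ({P \<in> fib_polyominoes m n. 2 \<le> last_column_height P} // translation_rel))
      = catalan m * real (binom (n - 2) (int m - 1))"
proof -
  note b = bij_betw_fib_polyominoes[of m n "\<lambda>k. 2 \<le> k"]
  note b' = height_lists_last_ge_2[OF assms(1), of n]
  have "finite (height_lists (Suc m) n 1)" by (simp add: finite_height_lists)
  then show "finite ({P \<in> fib_polyominoes m n. 2 \<le> last_column_height P} // translation_rel)"
    using b b' by (metis (no_types, lifting) bij_betw_finite)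
  obtain M where M: "m = Suc M" using assms by (cases m) auto
  have "card ({P \<in> fib_polyominoes m n. 2 \<le> last_column_height P} // translation_rel)
      = card (height_lists (Suc m) n 1)"
    using bij_betw_same_card[OF b] bij_betw_same_card[OF b'] by simp
  then show "real (card ({P \<in> fib_polyominoes m n. 2 \<le> last_column_height P} // translation_rel))
      = catalan m * real (binom (n - 2) (int m - 1))"
    using card_height_lists_last_1[OF assms(2), of M] by (simp add: M binom_def)
qed

lemma fib_polyominoes_last_eq_1:
  assumes "1 \<le> m" "2 \<le> n"
  shows "finite ({P \<in> fib_polyominoes m n. last_column_height P = 1} // translation_rel)"
    and "real (card ({P \<in> fib_polyominoes m n. last_column_height P = 1} // translation_rel))
      = catalan (m - 1) * real (binom (n - 2) (int m - 2))"
proof -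
  note b = bij_betw_fib_polyominoes[of m n "\<lambda>k. k = 1", unfolded height_lists_last_eq_1[OF assms(1)]]
  show "finite ({P \<in> fib_polyominoes m n. last_column_height P = 1} // translation_rel)"
    using bij_betw_finite[OF b] finite_height_lists[OF assms(1)] by simp
  have card: "card ({P \<in> fib_polyominoes m n. last_column_height P = 1} // translation_rel)
      = card (height_lists m n 1)"
    using bij_betw_same_card[OF b] by simp
  show "real (card ({P \<in> fib_polyominoes m n. last_column_height P = 1} // translation_rel))
      = catalan (m - 1) * real (binom (n - 2) (int m - 2))"
  proof (cases "m = 1")
    case True
    \<comment> \<open>A single column of height 1 would need \<open>n = 1\<close>, and the lower
      index of \<open>binom\<close> is \<open>-1\<close>: both sides are 0.\<close>
    then show ?thesis using card assms by (simp add: height_lists_1[unfolded One_nat_def] binom_def)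
  next
    case False
    then obtain M where M: "m = Suc (Suc M)" using assms by (metis One_nat_def Suc_le_D le_antisym not_less_eq_eq)
    then show ?thesis using card card_height_lists_last_1[OF assms(2), of M] by (simp add: binom_def)
  qed
qed

text \<open>All three quotients are images of sets of height lists under one map, injective on the
  largest set, so the split and the disjointness carry over from lists.\<close>

lemma fib_polyominoes_quotient_split:
  shows "fib_polyominoes m n // translation_rel
    = {P \<in> fib_polyominoes m n. 2 \<le> last_column_height P} // translation_rel
      \<union> {P \<in> fib_polyominoes m n. last_column_height P = 1} // translation_rel" (is "?Q = ?A \<union> ?B")
  and "({P \<in> fib_polyominoes m n. 2 \<le> last_column_height P} // translation_rel)
      \<inter> ({P \<in> fib_polyominoes m n. last_column_height P = 1} // translation_rel) = {}"
proof -
  let ?f = "\<lambda>hs. translation_rel `` {staircase hs}"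
  let ?H = "\<lambda>R. {hs. staircase_heights hs \<and> length hs = m \<and> upward_variation hs = n \<and> R (hs ! (length hs - 1))}"
  have Q: "?Q = ?f ` ?H (\<lambda>_. True)" and inj: "inj_on ?f (?H (\<lambda>_. True))"
    using bij_betw_fib_polyominoes[of m n "\<lambda>_. True"] by (auto simp: bij_betw_def)
  have A: "?A = ?f ` ?H (\<lambda>k. 2 \<le> k)" using bij_betw_fib_polyominoes[of m n "\<lambda>k. 2 \<le> k"] by (simp add: bij_betw_def)
  have B: "?B = ?f ` ?H (\<lambda>k. k = 1)" using bij_betw_fib_polyominoes[of m n "\<lambda>k. k = 1"] by (simp add: bij_betw_def)
  have H: "?H (\<lambda>_. True) = ?H (\<lambda>k. 2 \<le> k) \<union> ?H (\<lambda>k. k = 1)"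
    by (auto simp: staircase_heights_def)
  show "?Q = ?A \<union> ?B" unfolding Q A B H by (rule image_Un)
  have "?H (\<lambda>k. 2 \<le> k) \<inter> ?H (\<lambda>k. k = 1) = {}" by auto
  then show "?A \<inter> ?B = {}" unfolding A B
    using inj_on_image_Int[OF inj, of "?H (\<lambda>k. 2 \<le> k)" "?H (\<lambda>k. k = 1)"] by auto
qed

theorem theorem3p2:
  shows "(\<forall>m n :: nat. m \<ge> 1 \<longrightarrow> n \<ge> 2 \<longrightarrow>
       finite (fib_polyominoes m n // translation_rel) \<and>
       real (num_fib_polyominoes m n) = catalan m * real (binom (n - 2) (int m - 1))
                    + catalan (m - 1) * real (binom (n - 2) (int m - 2)) \<and>
       real (card ({P \<in> fib_polyominoes m n. last_column_height P \<ge> 2} // translation_rel))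
         = catalan m * real (binom (n - 2) (int m - 1)) \<and>
       real (card ({P \<in> fib_polyominoes m n. last_column_height P = 1} // translation_rel))
         = catalan (m - 1) * real (binom (n - 2) (int m - 2)))
     \<and> (\<forall>n :: nat. n \<ge> 2 \<longrightarrow> real (num_fib_polyominoes n n) = catalan (n - 1))"
proof -
  have fin: "finite (fib_polyominoes m n // translation_rel)" if "1 \<le> m" "2 \<le> n" for m n
    unfolding fib_polyominoes_quotient_split(1)
    using fib_polyominoes_last_ge_2(1) fib_polyominoes_last_eq_1(1) that by blast
  have num: "real (num_fib_polyominoes m n) = catalan m * real (binom (n - 2) (int m - 1))
      + catalan (m - 1) * real (binom (n - 2) (int m - 2))" if "1 \<le> m" "2 \<le> n" for m n
    unfolding num_fib_polyominoes_def fib_polyominoes_quotient_split(1)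
    by (subst card_Un_disjoint)
       (use fib_polyominoes_last_ge_2[OF that] fib_polyominoes_last_eq_1[OF that]
          fib_polyominoes_quotient_split(2) in \<open>simp_all only: of_nat_add\<close>)
  have "real (num_fib_polyominoes n n) = catalan (n - 1)" if "2 \<le> n" for n
  proof -
    \<comment> \<open>On the diagonal the first binomial is \<open>n - 2\<close> over
      \<open>n - 1\<close>, hence 0, and the second is 1.\<close>
    have "nat (int n - 1) = Suc (n - 2)" "nat (int n - 2) = n - 2" using that by simp_all
    then show ?thesis using num[of n n] that by (simp add: binom_def)
  qed
  then show ?thesis
    using fin num fib_polyominoes_last_ge_2(2) fib_polyominoes_last_eq_1(2) by blast
qed

end
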